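(* Let $R$ be an integral domain with $1$, let $d\ge 0$ and let $p(t)=a_0+a_1t+\cdots+a_dt^d\in R[t]$ have degree $d$ with $a_0\neq 0$. For $k\ge 0$ define $C_{i,k}$ by $\frac{(tp(t))^k}{1-t^{d+1}}=\sum_{i\ge0}C_{i,k}t^i$. Let $V_{p(t)}$ be the $(d+1)\times(d+1)$ circulant matrix $$V_{p(t)}=\begin{pmatrix} a_d & a_{d-1} & \cdots & a_1 & a_0\\ a_0 & a_{d} & \cdots & a_2 & a_1\\ \vdots & \vdots & \ddots & \vdots & \vdots\\ a_{d-2} & a_{d-3} & \cdots & a_d & a_{d-1}\\ a_{d-1} & a_{d-2} & \cdots & a_0 & a_d \end{pmatrix},$$ whose $i$-th row ($i=0,\dots,d$) is $T^i(a_d,a_{d-1},\dots,a_0)$ with $T(x_d,x_{d-1},\dots,x_1,x_0)=(x_0,x_d,x_{d-1},\dots,x_1)$. Then for every integer $n\ge 0$, $$V_{p(t)}^n\begin{pmatrix}a_0\\ a_1\\ \vdots\\ a_d\end{pmatrix}=\begin{pmatrix}C_{1+n(d+1),\,n+1}\\ C_{1+n(d+1)+1,\,n+1}\\ \vdots\\ C_{1+n(d+1)+d,\,n+1}\end{pmatrix}.$$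
   Context: $C_{i,k}$ is the entry in row $i$, column $k$ (indexed from $0$) of the Riordan array $\bigl(1/(1-t^{d+1}),\,tp(t)\bigr)$, the infinite lower triangular matrix whose $k$-th column has generating function $(tp(t))^k/(1-t^{d+1})$. *)

theory Defs
  imports
    "Jordan_Normal_Form.Matrix"
    "HOL-Computational_Algebra.Polynomial_FPS"
begin

definition riordan_array :: "'a::comm_ring_1 fps \<Rightarrow> 'a fps \<Rightarrow> nat \<Rightarrow> nat \<Rightarrow> 'a" where
  "riordan_array g f i k = fps_nth (g * f ^ k) i"

text \<open>
  Division of power series needs coefficients with an inverse operation.  Over a domain the
  reciprocal of \<open>1 - t ^ (d + 1)\<close>, whose constant term is \<open>1\<close>, is obtained from
  \<open>fps_right_inverse\<close>; its second argument is the inverse of the constant term.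
\<close>

definition C_entry :: "'a::idom poly \<Rightarrow> nat \<Rightarrow> nat \<Rightarrow> 'a" where
  "C_entry p = riordan_array
     (fps_right_inverse (1 - fps_X ^ (degree p + 1)) 1)
     (fps_X * fps_of_poly p)"

lemma C_entry_genfun:
  fixes p :: "'a::idom poly"
  shows "(1 - fps_X ^ (degree p + 1)) * Abs_fps (\<lambda>i. C_entry p i k)
           = (fps_X * fps_of_poly p) ^ k"
proof -
  have "(1 - fps_X ^ (degree p + 1)) * fps_right_inverse (1 - fps_X ^ (degree p + 1)) (1::'a) = 1"
    by (rule fps_right_inverse) simp
  moreover have "Abs_fps (\<lambda>i. C_entry p i k) =
      fps_right_inverse (1 - fps_X ^ (degree p + 1)) 1 * (fps_X * fps_of_poly p) ^ k"
    by (simp add: C_entry_def riordan_array_def fps_eq_iff)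
  ultimately show ?thesis
    by (simp add: mult.assoc [symmetric])
qed

definition cyclic_shift :: "'a list \<Rightarrow> 'a list" where
  "cyclic_shift xs = last xs # butlast xs"

definition circulant_V :: "'a::zero poly \<Rightarrow> 'a mat" where
  "circulant_V p = mat_of_rows_list (degree p + 1)
     (map (\<lambda>i. (cyclic_shift ^^ i) (map (poly.coeff p) (rev [0..<degree p + 1])))
       [0..<degree p + 1])"

lemma length_cyclic_shift_funpow:
  assumes "xs \<noteq> []"
  shows "length ((cyclic_shift ^^ i) xs) = length xs"
proof (induction i)
  case (Suc i)
  then show ?case using assms by (cases "length xs") (auto simp: cyclic_shift_def)
qed simp

lemma nth_cyclic_shift_funpow:
  assumes "i \<le> length xs" "j < length xs"
  shows "(cyclic_shift ^^ i) xs ! j = xs ! ((length xs + j - i) mod length xs)"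
  using assms
proof (induction i arbitrary: j)
  case (Suc i)
  let ?n = "length xs" and ?ys = "(cyclic_shift ^^ i) xs"
  have ne: "xs \<noteq> []" using Suc.prems by auto
  have len: "length ?ys = ?n" using ne by (rule length_cyclic_shift_funpow)
  then have ne': "?ys \<noteq> []" using ne by auto
  show ?case
  proof (cases j)
    case 0
    have "(cyclic_shift ^^ Suc i) xs ! j = ?ys ! (?n - 1)"
      using 0 ne' len by (simp add: cyclic_shift_def last_conv_nth)
    also have "\<dots> = xs ! ((?n + (?n - 1) - i) mod ?n)"
      using Suc.prems by (intro Suc.IH) auto
    also have "?n + (?n - 1) - i = (?n + j - Suc i) + ?n"
      using Suc.prems 0 by simp
    finally show ?thesis by simp
  next
    case (Suc m)
    have "(cyclic_shift ^^ Suc i) xs ! j = ?ys ! m"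
      using Suc Suc.prems len by (simp add: cyclic_shift_def nth_butlast)
    also have "\<dots> = xs ! ((?n + m - i) mod ?n)"
      using Suc Suc.prems by (intro Suc.IH) auto
    finally show ?thesis using Suc by simp
  qed
qed simp

lemma circulant_V_carrier: "circulant_V p \<in> carrier_mat (degree p + 1) (degree p + 1)"
  by (simp add: circulant_V_def mat_of_rows_list_def)

lemma circulant_V_index:
  assumes "i \<le> degree p" "j \<le> degree p"
  shows "circulant_V p $$ (i, j) = poly.coeff p ((degree p + i - j) mod (degree p + 1))"
proof -
  let ?d = "degree p"
  let ?xs = "map (poly.coeff p) (rev [0..<?d + 1])"
  have "circulant_V p $$ (i, j) = (cyclic_shift ^^ i) ?xs ! j"
    using assms by (simp add: circulant_V_def mat_of_rows_list_def del: upt_Suc)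
  also have "\<dots> = ?xs ! ((?d + 1 + j - i) mod (?d + 1))"
    using assms by (subst nth_cyclic_shift_funpow) auto
  also have "\<dots> = poly.coeff p (?d - (?d + 1 + j - i) mod (?d + 1))"
    using mod_less_divisor[of "?d + 1" "?d + 1 + j - i"]
    by (simp add: rev_nth del: upt_Suc mod_less_divisor)
  also have "?d - (?d + 1 + j - i) mod (?d + 1) = (?d + i - j) mod (?d + 1)"
  proof (cases "i \<le> j")
    case True
    then have "?d + 1 + j - i = (j - i) + (?d + 1)" by simp
    then have "(?d + 1 + j - i) mod (?d + 1) = j - i"
      using assms by (metis Suc_eq_plus1 diff_le_self le_trans less_Suc_eq_le mod_add_self2 mod_less)
    moreover have "(?d + i - j) mod (?d + 1) = ?d + i - j"
      using True by simp
    ultimately show ?thesis using True assms by simp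
  next
    case False
    then have "?d + i - j = (i - j - 1) + (?d + 1)" by simp
    then have "(?d + i - j) mod (?d + 1) = (i - j - 1) mod (?d + 1)"
      by (metis mod_add_self2)
    then show ?thesis using False assms by simp
  qed
  finally show ?thesis .
qed

end

theory Submission imports Defs begin

text \<open>
  Write \<open>m = d + 1\<close>.  Multiplying column \<open>k\<close> of the array by \<open>t p(t)\<close> gives column \<open>k + 1\<close>, so
  \<open>C(1 + s, k + 1)\<close> is the convolution of \<open>a\<^sub>0, \<dots>, a\<^sub>d\<close> with the window
  \<open>C(s, k), \<dots>, C(s - d, k)\<close>.  Since \<open>(t p(t))\<^sup>k\<close> has degree at most \<open>k m\<close>, the sequence
  \<open>C(i, k)\<close> is \<open>m\<close>-periodic for \<open>i > (k - 1) m\<close>.  Hence beyond that point the linear convolution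
  is a cyclic one, which is multiplication by the circulant matrix.
\<close>

lemma C_entry_Suc:
  fixes p :: "'a::idom poly"
  shows "C_entry p (Suc s) (Suc k) = (\<Sum>l=0..s. poly.coeff p l * C_entry p (s - l) k)"
proof -
  let ?g = "fps_right_inverse (1 - fps_X ^ (degree p + 1)) (1 :: 'a)" and ?P = "fps_of_poly p"
  have "C_entry p (Suc s) (Suc k) = fps_nth (fps_X * (?P * (?g * (fps_X * ?P) ^ k))) (Suc s)"
    by (simp add: C_entry_def riordan_array_def mult_ac)
  also have "\<dots> = fps_nth (?P * (?g * (fps_X * ?P) ^ k)) s"
    by simp
  also have "\<dots> = (\<Sum>l=0..s. poly.coeff p l * C_entry p (s - l) k)"
    unfolding fps_mult_nth[of ?P] by (simp add: C_entry_def riordan_array_def)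
  finally show ?thesis .
qed

text \<open>Coefficients beyond \<open>degree p\<close> vanish. The assumption keeps the whole
  window inside \<open>0..s\<close>, so the natural subtraction \<open>s - l\<close> never
  truncates.\<close>

lemma C_entry_Suc_window:
  assumes "degree p \<le> s"
  shows "C_entry p (Suc s) (Suc k) = (\<Sum>l\<le>degree p. poly.coeff p l * C_entry p (s - l) k)"
  unfolding C_entry_Suc using assms
  by (intro sum.mono_neutral_right) (auto simp: coeff_eq_0)

text \<open>Compares coefficients in (1 - t^(d+1)) F = (t p)^k, where F generates column k.\<close>

lemma C_entry_recurrence:
  "C_entry p i k = (if i \<le> degree p then 0 else C_entry p (i - (degree p + 1)) k)
     + fps_nth ((fps_X * fps_of_poly p) ^ k) i"
proof -
  let ?F = "Abs_fps (\<lambda>i. C_entry p i k)"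
  have "fps_nth ((fps_X * fps_of_poly p) ^ k) i = fps_nth (?F - fps_X ^ (degree p + 1) * ?F) i"
    by (simp only: C_entry_genfun[symmetric] left_diff_distrib mult_1_left)
  then show ?thesis
    by (simp add: fps_X_power_mult_nth del: power_Suc)
qed

text \<open>The assumption puts the index \<open>i + (degree p + 1)\<close> above the degree bound
  k(d+1) of (t p)^k, so the inhomogeneous term of the recurrence is zero there.\<close>

lemma C_entry_periodic:
  assumes "k * (degree p + 1) < i + (degree p + 1)"
  shows "C_entry p (i + (degree p + 1)) k = C_entry p i k"
proof -
  let ?q = "([:0, 1:] * p) ^ k"
  have "degree ?q \<le> k * degree ([:0, 1:] * p)"
    by (metis degree_power_le mult.commute)
  also have "\<dots> \<le> k * (degree p + 1)"
    by (intro mult_le_mono2) (simp add: degree_pCons_le)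
  finally have "poly.coeff ?q (i + (degree p + 1)) = 0"
    using assms by (intro coeff_eq_0) simp
  moreover have "fps_of_poly ?q = (fps_X * fps_of_poly p) ^ k"
    by (simp add: fps_of_poly_power fps_of_poly_mult fps_of_poly_pCons)
  ultimately have "fps_nth ((fps_X * fps_of_poly p) ^ k) (i + (degree p + 1)) = 0"
    by (metis fps_of_poly_nth)
  then show ?thesis
    using C_entry_recurrence[of p "i + (degree p + 1)" k] by simp
qed

lemma C_entry_column_1:
  assumes "i \<le> degree p"
  shows "C_entry p (Suc i) 1 = poly.coeff p i"
  \<comment> \<open>For \<open>i = degree p\<close> the recurrence reaches back to index 0; its
    second instance shows that this entry is 0.\<close>
  using C_entry_recurrence[of p "Suc i" 1] C_entry_recurrence[of p 0 1] assms by (auto split: if_splits)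

text \<open>Powers unfold with the new factor on the right, but the induction on n applies one more
  V from the left.\<close>

lemma pow_mat_Suc_left:
  assumes "A \<in> carrier_mat n n"
  shows "A ^\<^sub>m Suc k = A * A ^\<^sub>m k"
proof (induction k)
  case (Suc k)
  have "A ^\<^sub>m Suc (Suc k) = (A * A ^\<^sub>m k) * A"
    using Suc by simp
  also have "\<dots> = A * (A ^\<^sub>m k * A)"
    using assms by (intro assoc_mult_mat) auto
  finally show ?case by simp
qed (use assms in simp)

lemma circulant_V_mult_C_entry:
  fixes p :: "'a::idom poly"
  defines "m \<equiv> degree p + 1"
  shows "circulant_V p *\<^sub>v vec m (\<lambda>j. C_entry p (1 + n * m + j) (n + 1))
           = vec m (\<lambda>i. C_entry p (1 + (n + 1) * m + i) (n + 2))"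
proof (rule eq_vecI)
  show "dim_vec (circulant_V p *\<^sub>v vec m (\<lambda>j. C_entry p (1 + n * m + j) (n + 1)))
      = dim_vec (vec m (\<lambda>i. C_entry p (1 + (n + 1) * m + i) (n + 2)))"
    using circulant_V_carrier[of p] by (simp add: m_def)
next
  fix i assume "i < dim_vec (vec m (\<lambda>i. C_entry p (1 + (n + 1) * m + i) (n + 2)))"
  then have i: "i \<le> degree p" by (simp add: m_def)
  \<comment> \<open>Row i of V has a_(r j) in column j. Since j + r j is congruent to d + i mod m, r
    is an involution of {0..d}.\<close>
  define r where "r j = (degree p + i - j) mod m" for j
  have r: "r j = (if i \<le> j then degree p + i - j else i - j - 1)" if "j \<le> degree p" for j
  proof (cases "i \<le> j")
    case False
    then have "degree p + i - j = (i - j - 1) + m" by (simp add: m_def)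
    then have "r j = (i - j - 1) mod m" by (simp add: r_def)
    then show ?thesis using False i by (simp add: m_def)
  qed (use that in \<open>simp add: r_def m_def\<close>)
  have r_le: "r j \<le> degree p" and r_r: "r (r j) = j" if "j \<le> degree p" for j
    using that i r[OF that] r[of "r j"] by (auto split: if_splits)
  \<comment> \<open>The two indices agree for i \<le> j and differ by exactly one period m
    otherwise; the larger one then exceeds (n + 1) m, as periodicity requires.\<close>
  have entry: "C_entry p (1 + n * m + j) (n + 1) = C_entry p ((n + 1) * m + i - r j) (n + 1)"
    if "j \<le> degree p" for j
  proof (cases "i \<le> j")
    case True
    then show ?thesis using that r[OF that] by (simp add: m_def add.assoc)
  next
    case False
    then have "(n + 1) * m + i - r j = (1 + n * m + j) + (degree p + 1)"
      using r[OF that] by (simp add: m_def)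
    then show ?thesis
      using C_entry_periodic[of "n + 1" p "1 + n * m + j"] by (simp add: m_def)
  qed
  have "(circulant_V p *\<^sub>v vec m (\<lambda>j. C_entry p (1 + n * m + j) (n + 1))) $ i
      = (\<Sum>j\<le>degree p. circulant_V p $$ (i, j) * C_entry p (1 + n * m + j) (n + 1))"
    using i circulant_V_carrier[of p]
    by (auto simp: scalar_prod_def m_def atLeast0LessThan lessThan_Suc_atMost
        simp del: sum.op_ivl_Suc sum.lessThan_Suc intro!: sum.cong)
  also have "\<dots> = (\<Sum>j\<le>degree p. poly.coeff p (r j) * C_entry p ((n + 1) * m + i - r j) (n + 1))"
    using i by (intro sum.cong refl arg_cong2[of _ _ _ _ "(*)"] entry)
      (auto simp: circulant_V_index r_def m_def)
  \<comment> \<open>Substitute l = r j; the involution r is its own inverse witness. The cyclic sum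
    becomes the linear convolution.\<close>
  also have "\<dots> = (\<Sum>l\<le>degree p. poly.coeff p l * C_entry p ((n + 1) * m + i - l) (n + 1))"
    by (rule sum.reindex_bij_witness[of _ r r]) (auto simp: r_le r_r)
  also have "\<dots> = C_entry p (Suc ((n + 1) * m + i)) (Suc (n + 1))"
    by (rule C_entry_Suc_window[symmetric]) (simp add: m_def)
  finally show "(circulant_V p *\<^sub>v vec m (\<lambda>j. C_entry p (1 + n * m + j) (n + 1))) $ i
      = vec m (\<lambda>i. C_entry p (1 + (n + 1) * m + i) (n + 2)) $ i"
    using i by (simp add: m_def)
qed

theorem theorem2:
  fixes p :: "'a::idom poly" and d n :: nat
  assumes "degree p = d"
    and "poly.coeff p 0 \<noteq> 0"
  shows "(circulant_V p ^\<^sub>m n) *\<^sub>v vec (d + 1) (\<lambda>i. poly.coeff p i)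
           = vec (d + 1) (\<lambda>i. C_entry p (1 + n * (d + 1) + i) (n + 1))"
proof (induction n)
  case 0
  \<comment> \<open>The zeroth power is the identity matrix of size \<open>dim_row\<close>, so this
    size must match the vector.\<close>
  have "dim_row (circulant_V p) = d + 1"
    using circulant_V_carrier[of p] assms(1) by simp
  then show ?case
    using assms(1) C_entry_column_1[of _ p] by (auto simp: one_mult_mat_vec)
next
  case (Suc n)
  let ?V = "circulant_V p" and ?a = "vec (d + 1) (\<lambda>i. poly.coeff p i)"
  have V: "?V \<in> carrier_mat (d + 1) (d + 1)"
    using circulant_V_carrier[of p] assms(1) by simp
  have "(?V ^\<^sub>m Suc n) *\<^sub>v ?a = (?V * ?V ^\<^sub>m n) *\<^sub>v ?a"
    by (simp only: pow_mat_Suc_left[OF V])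
  also have "\<dots> = ?V *\<^sub>v (?V ^\<^sub>m n *\<^sub>v ?a)"
    using V by (intro assoc_mult_mat_vec) auto
  also have "\<dots> = vec (d + 1) (\<lambda>i. C_entry p (1 + (n + 1) * (d + 1) + i) (n + 2))"
    unfolding Suc using circulant_V_mult_C_entry[of p n] assms(1) by simp
  finally show ?case by simp
qed

end
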